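(* Let $C$ be a group with subgroups $A_1,A_2$ satisfying one of the following assumptions: (a) $A_2$ is commensurated in $C$, and $A_1$ is generated by $A_1\cap A_2$ together with finitely many elements; (b) both $A_1$ and $A_2$ are commensurated in $C$, and $A_2$ is generated by $A_1\cap A_2$ together with finitely many elements. Then there is a subgroup $A$ of $C$, unique up to commensurability, such that: (1) $A_1$ and $A_2$ are virtually contained in $A$; (2) for every subgroup $B$ of $C$ such that $A_1$ and $A_2$ are virtually contained in $B$, $A$ is virtually contained in $B$. Moreover one can take $A=\langle A_1,A_2'\rangle$ for some finite index subgroup $A_2'$ of $A_2$, and $A_2'$ can be taken to be a finite intersection of conjugates of $A_2$.
   Context: Two subgroups of a group are commensurable if their intersection has finite index in each of them. A subgroup $H$ of a group $C$ is commensurated in $C$ if $H$ and $cHc^{-1}$ are commensurable for every $c\in C$. A subgroup $H$ of $C$ is virtually contained in a subgroup $B$ of $C$ if some finite index subgroup of $H$ is contained in $B$. Conjugates are taken in $C$. *)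

theory Defs
  imports "HOL-Algebra.Algebra"
begin

text \<open>\<open>K\<close> and \<open>H\<close> are subgroups of the ambient group \<open>G\<close>; the index of \<open>K\<close> in \<open>H\<close> is the number
  of cosets of \<open>K\<close> in the group \<open>H\<close>, so the cosets are taken after restricting the carrier to \<open>H\<close>.\<close>

definition finite_index_subgroup ::
    "('a, 'b) monoid_scheme \<Rightarrow> 'a set \<Rightarrow> 'a set \<Rightarrow> bool" where
  "finite_index_subgroup G K H \<longleftrightarrow>
     subgroup K G \<and> subgroup H G \<and> K \<subseteq> H \<and> finite (rcosets\<^bsub>G\<lparr>carrier := H\<rparr>\<^esub> K)"

definition commensurable ::
    "('a, 'b) monoid_scheme \<Rightarrow> 'a set \<Rightarrow> 'a set \<Rightarrow> bool" where
  "commensurable G H K \<longleftrightarrow>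
     finite_index_subgroup G (H \<inter> K) H \<and> finite_index_subgroup G (H \<inter> K) K"

definition conjugate_subgroup ::
    "('a, 'b) monoid_scheme \<Rightarrow> 'a \<Rightarrow> 'a set \<Rightarrow> 'a set" where
  "conjugate_subgroup G c H = c <#\<^bsub>G\<^esub> H #>\<^bsub>G\<^esub> inv\<^bsub>G\<^esub> c"

definition commensurated ::
    "('a, 'b) monoid_scheme \<Rightarrow> 'a set \<Rightarrow> bool" where
  "commensurated G H \<longleftrightarrow>
     subgroup H G \<and> (\<forall>c\<in>carrier G. commensurable G H (conjugate_subgroup G c H))"

definition virtually_contained ::
    "('a, 'b) monoid_scheme \<Rightarrow> 'a set \<Rightarrow> 'a set \<Rightarrow> bool" where
  "virtually_contained G H B \<longleftrightarrow> (\<exists>K. finite_index_subgroup G K H \<and> K \<subseteq> B)"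

definition finitely_generated_over ::
    "('a, 'b) monoid_scheme \<Rightarrow> 'a set \<Rightarrow> 'a set \<Rightarrow> bool" where
  "finitely_generated_over G H K \<longleftrightarrow>
     (\<exists>F. finite F \<and> F \<subseteq> carrier G \<and> H = generate G (K \<union> F))"

definition smallest_virtual_container ::
    "('a, 'b) monoid_scheme \<Rightarrow> 'a set \<Rightarrow> 'a set \<Rightarrow> 'a set \<Rightarrow> bool" where
  "smallest_virtual_container G A1 A2 A \<longleftrightarrow>
     subgroup A G \<and> virtually_contained G A1 A \<and> virtually_contained G A2 A \<and>
     (\<forall>B. subgroup B G \<and> virtually_contained G A1 B \<and> virtually_contained G A2 B \<longrightarrow>
        virtually_contained G A B)"

end

theory Submission
  imports Defs
begin

text \<open>Suppose first that \<open>A1 = \<langle>A1 \<inter> A2, F\<rangle>\<close> with \<open>F\<close> finite and \<open>A2\<close> commensurated. The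
  candidates for the least container are the groups \<open>\<langle>A1, M\<rangle>\<close>, where \<open>M \<subseteq> A2\<close> is a finite
  intersection of conjugates of \<open>A2\<close>. What is needed is an \<open>M\<close> such that shrinking it further changes the
  join only up to finite index: for every \<open>L \<subseteq> M\<close> of finite index in \<open>A2\<close>, the group \<open>B = \<langle>A1, L\<rangle>\<close>
  must have finite index in \<open>A = \<langle>A1, M\<rangle>\<close>.

  The group \<open>A\<close> acts on the cosets of \<open>A2\<close>, and it is generated by \<open>A \<inter> A2\<close> and \<open>F\<close>. So \<open>B\<close>
  is transitive on the \<open>A\<close>-orbit of the base point as soon as every \<open>u \<in> A \<inter> A2\<close> acts on the finitely many
  cosets \<open>f A2\<close> and \<open>f\<^sup>-\<^sup>1 A2\<close> like some element of \<open>B\<close>: a path of generators can then be followed with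
  elements of \<open>B\<close>, which gives \<open>A \<subseteq> B A2\<close> and hence finite index (\<open>join_coset_finite_if_dense\<close>). Let
  \<open>K\<close> be the intersection of \<open>A2\<close> with its conjugates by \<open>f\<close> and \<open>f\<^sup>-\<^sup>1\<close>, for \<open>f \<in> F\<close>. It fixes these
  cosets and has finite index in \<open>A2\<close>, so \<open>M\<close> can be chosen such that \<open>A \<inter> A2\<close> meets the fewest cosets
  of \<open>K\<close>.

  This minimality only compares \<open>M\<close> with other intersections of conjugates, while \<open>L\<close> is an arbitrary
  finite index subgroup, which need not contain one. The remedy is to regard the intersections of conjugates
  of \<open>A2\<close> as a neighbourhood base of the identity: the closure of \<open>L\<close> does contain one, say
  \<open>M1\<close>, and \<open>\<langle>A1, M1\<rangle>\<close> lies in the closure of \<open>\<langle>A1, L\<rangle>\<close> (\<open>generate_dense\<close>). Modulo the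
  neighbourhood \<open>K\<close>, every element of \<open>A \<inter> A2\<close> agrees with one of \<open>\<langle>A1, M1\<rangle>\<close> by minimality, and hence
  with one of \<open>\<langle>A1, L\<rangle>\<close> by density (\<open>commensurated_join_stable\<close>).

  A group \<open>B\<close> that contains \<open>A1\<close> and \<open>A2\<close> only virtually is reduced to one that contains \<open>A1\<close> by
  intersecting its conjugates under \<open>A1\<close>. There are only finitely many of these, because \<open>A1 \<inter> B\<close> has finite
  index in \<open>A1\<close>; the intersection \<open>D\<close> is normalised by \<open>A1\<close>, and \<open>A1 D\<close> is virtually contained in
  \<open>D \<subseteq> B\<close> (\<open>core_virtually_contained\<close>).

  When instead \<open>A2\<close> is finitely generated over \<open>A1 \<inter> A2\<close> and both are commensurated, the first case
  with the roles exchanged gives a least container \<open>E = \<langle>A2, P\<rangle>\<close>. The same core construction applied to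
  \<open>E\<close> produces a group \<open>A1 D\<close> virtually contained in \<open>E\<close>, and \<open>D\<close> contains a finite intersection
  of conjugates of \<open>A2\<close>, because \<open>E\<close> contains \<open>A2\<close>.

  Uniqueness is formal: two least containers are virtually contained in each other.\<close>

section \<open>Conjugates and their finite intersections\<close>

text \<open>For subgroups \<open>H\<close> and \<open>B\<close> this says that \<open>H \<inter> B\<close> has finite index in \<open>H\<close>. Counting cosets of
  \<open>B\<close> itself keeps the subgroup \<open>H \<inter> B\<close> out of the formulas, so that restriction, enlargement and
  transitivity become statements about images.\<close>

definition coset_finite :: "('a, 'b) monoid_scheme \<Rightarrow> 'a set \<Rightarrow> 'a set \<Rightarrow> bool" where
  "coset_finite G H B \<longleftrightarrow> finite ((\<lambda>h. B #>\<^bsub>G\<^esub> h) ` H)"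

text \<open>The conjugators need not include the identity. This makes the family closed under conjugation, at the
  price that its members need not lie in \<open>H\<close>.\<close>

definition conjugate_meets :: "('a, 'b) monoid_scheme \<Rightarrow> 'a set \<Rightarrow> 'a set set" where
  "conjugate_meets G H =
     {\<Inter>c\<in>S. conjugate_subgroup G c H | S. finite S \<and> S \<noteq> {} \<and> S \<subseteq> carrier G}"

lemma finite_image_factor:
  assumes "finite (f ` H)" and "\<And>x y. x \<in> H \<Longrightarrow> y \<in> H \<Longrightarrow> f x = f y \<Longrightarrow> g x = g y"
  shows "finite (g ` H)"
proof -
  have "g ` H \<subseteq> (\<lambda>v. g (SOME x. x \<in> H \<and> f x = v)) ` (f ` H)"
  proof
    fix w assume "w \<in> g ` H"
    then obtain x where x: "x \<in> H" "w = g x" by auto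
    have "(SOME z. z \<in> H \<and> f z = f x) \<in> H \<and> f (SOME z. z \<in> H \<and> f z = f x) = f x"
      by (rule someI[of _ x]) (use x in auto)
    then have "g (SOME z. z \<in> H \<and> f z = f x) = g x" using assms(2) x by blast
    then show "w \<in> (\<lambda>v. g (SOME x. x \<in> H \<and> f x = v)) ` (f ` H)" using x
      by (intro image_eqI[where x = "f x"]) auto
  qed
  then show ?thesis using assms(1) finite_surj by blast
qed

context group
begin

lemma mult_inv_cancel:
  assumes "c \<in> carrier G" "x \<in> carrier G"
  shows "c \<otimes> (inv c \<otimes> x) = x" "inv c \<otimes> (c \<otimes> x) = x"
  using assms by (simp_all flip: m_assoc)

lemma mem_conjugate_subgroup:
  assumes "H \<subseteq> carrier G" "c \<in> carrier G"
  shows "x \<in> conjugate_subgroup G c H \<longleftrightarrow> x \<in> carrier G \<and> inv c \<otimes> x \<otimes> c \<in> H"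
proof
  assume "x \<in> conjugate_subgroup G c H"
  then obtain h where h: "h \<in> H" "x = c \<otimes> h \<otimes> inv c"
    unfolding conjugate_subgroup_def l_coset_def r_coset_def by auto
  then have "h \<in> carrier G" using assms by auto
  then show "x \<in> carrier G \<and> inv c \<otimes> x \<otimes> c \<in> H"
    using h assms by (simp add: m_assoc mult_inv_cancel)
next
  assume x: "x \<in> carrier G \<and> inv c \<otimes> x \<otimes> c \<in> H"
  have "x = c \<otimes> (inv c \<otimes> x \<otimes> c) \<otimes> inv c"
    using x assms by (simp add: m_assoc mult_inv_cancel)
  then show "x \<in> conjugate_subgroup G c H"
    using x unfolding conjugate_subgroup_def l_coset_def r_coset_def by blast
qed

lemma conj_mult:
  assumes "x \<in> carrier G" "y \<in> carrier G" "c \<in> carrier G"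
  shows "inv c \<otimes> (x \<otimes> y) \<otimes> c = (inv c \<otimes> x \<otimes> c) \<otimes> (inv c \<otimes> y \<otimes> c)"
  using assms by (simp add: m_assoc mult_inv_cancel)

lemma conj_inv:
  assumes "x \<in> carrier G" "c \<in> carrier G"
  shows "inv c \<otimes> inv x \<otimes> c = inv (inv c \<otimes> x \<otimes> c)"
  using assms by (simp add: m_assoc inv_mult_group)

lemma conj_conj:
  assumes "x \<in> carrier G" "c \<in> carrier G" "d \<in> carrier G"
  shows "inv (c \<otimes> d) \<otimes> x \<otimes> (c \<otimes> d) = inv d \<otimes> (inv c \<otimes> x \<otimes> c) \<otimes> d"
  using assms by (simp add: m_assoc inv_mult_group)

lemma subgroup_conjugate:
  assumes "subgroup H G" "c \<in> carrier G"
  shows "subgroup (conjugate_subgroup G c H) G"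
proof -
  interpret H: subgroup H G by fact
  note m = mem_conjugate_subgroup[OF H.subset assms(2)]
  show ?thesis
  proof (rule subgroupI)
    show "conjugate_subgroup G c H \<subseteq> carrier G" using m by auto
    have "\<one> \<in> conjugate_subgroup G c H" using m assms(2) by simp
    then show "conjugate_subgroup G c H \<noteq> {}" by blast
  qed (auto simp: m conj_inv conj_mult assms(2))
qed

lemma conjugate_one:
  assumes "H \<subseteq> carrier G"
  shows "conjugate_subgroup G \<one> H = H"
  using mem_conjugate_subgroup[OF assms one_closed] assms by auto

lemma conjugate_self:
  assumes "subgroup H G" "c \<in> H"
  shows "conjugate_subgroup G c H = H"
proof -
  interpret H: subgroup H G by fact
  have c: "c \<in> carrier G" using assms by auto
  have "x \<in> H" if "x \<in> carrier G" "inv c \<otimes> x \<otimes> c \<in> H" for x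
  proof -
    have "x = c \<otimes> (inv c \<otimes> x \<otimes> c) \<otimes> inv c"
      using that c by (simp add: m_assoc mult_inv_cancel)
    also have "\<dots> \<in> H" by (intro H.m_closed that assms(2) H.m_inv_closed)
    finally show ?thesis .
  qed
  moreover have "x \<in> carrier G \<and> inv c \<otimes> x \<otimes> c \<in> H" if "x \<in> H" for x
    using that assms(2) by simp
  ultimately show ?thesis unfolding set_eq_iff mem_conjugate_subgroup[OF H.subset c] by blast
qed

lemma subgroup_Inter_conjugates:
  assumes "subgroup H G" "S \<noteq> {}" "S \<subseteq> carrier G"
  shows "subgroup (\<Inter>c\<in>S. conjugate_subgroup G c H) G"
  by (rule subgroups_Inter) (use assms subgroup_conjugate in auto)

lemma conjugate_meetsI:
  "finite S \<Longrightarrow> S \<noteq> {} \<Longrightarrow> S \<subseteq> carrier G \<Longrightarrow>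
     (\<Inter>c\<in>S. conjugate_subgroup G c H) \<in> conjugate_meets G H"
  unfolding conjugate_meets_def by blast

lemma conjugate_meetsE:
  assumes "N \<in> conjugate_meets G H"
  obtains S where "finite S" "S \<noteq> {}" "S \<subseteq> carrier G"
    "N = (\<Inter>c\<in>S. conjugate_subgroup G c H)"
  using assms unfolding conjugate_meets_def by blast

lemma conjugate_meets_subgroup:
  assumes "subgroup H G" "N \<in> conjugate_meets G H"
  shows "subgroup N G"
  using assms(2) by (rule conjugate_meetsE) (simp add: subgroup_Inter_conjugates[OF assms(1)])

lemma conjugate_meets_self:
  "H \<subseteq> carrier G \<Longrightarrow> H \<in> conjugate_meets G H"
  using conjugate_meetsI[of "{\<one>}" H] by (simp add: conjugate_one)

lemma conjugate_meets_Int: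
  assumes "N \<in> conjugate_meets G H" "N' \<in> conjugate_meets G H"
  shows "N \<inter> N' \<in> conjugate_meets G H"
proof -
  obtain S where S: "finite S" "S \<noteq> {}" "S \<subseteq> carrier G"
    "N = (\<Inter>c\<in>S. conjugate_subgroup G c H)" using assms(1) by (rule conjugate_meetsE)
  obtain S' where S': "finite S'" "S' \<noteq> {}" "S' \<subseteq> carrier G"
    "N' = (\<Inter>c\<in>S'. conjugate_subgroup G c H)" using assms(2) by (rule conjugate_meetsE)
  have "N \<inter> N' = (\<Inter>c\<in>S \<union> S'. conjugate_subgroup G c H)"
    unfolding S(4) S'(4) by (simp only: INT_Un)
  then show ?thesis using conjugate_meetsI[of "S \<union> S'" H] S(1-3) S'(1-3) by simp
qed

lemma conjugate_meets_conjugate: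
  assumes "H \<subseteq> carrier G" "N \<in> conjugate_meets G H" "b \<in> carrier G"
  shows "conjugate_subgroup G b N \<in> conjugate_meets G H"
proof -
  obtain S where S: "finite S" "S \<noteq> {}" "S \<subseteq> carrier G"
    "N = (\<Inter>c\<in>S. conjugate_subgroup G c H)" using assms(2) by (rule conjugate_meetsE)
  have mN: "x \<in> N \<longleftrightarrow> x \<in> carrier G \<and> (\<forall>c\<in>S. inv c \<otimes> x \<otimes> c \<in> H)" for x
  proof -
    have "x \<in> N \<longleftrightarrow> (\<forall>c\<in>S. x \<in> conjugate_subgroup G c H)" unfolding S(4) by simp
    also have "\<dots> \<longleftrightarrow> (\<forall>c\<in>S. x \<in> carrier G \<and> inv c \<otimes> x \<otimes> c \<in> H)"
      by (rule ball_cong[OF refl]) (use S(3) mem_conjugate_subgroup[OF assms(1)] in blast)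
    also have "\<dots> \<longleftrightarrow> x \<in> carrier G \<and> (\<forall>c\<in>S. inv c \<otimes> x \<otimes> c \<in> H)"
      using S(2) by blast
    finally show ?thesis .
  qed
  have N: "N \<subseteq> carrier G" using mN by blast
  have "x \<in> conjugate_subgroup G b N \<longleftrightarrow> x \<in> (\<Inter>c\<in>S. conjugate_subgroup G (b \<otimes> c) H)" for x
  proof -
    have "x \<in> conjugate_subgroup G b N \<longleftrightarrow>
        x \<in> carrier G \<and> (\<forall>c\<in>S. inv c \<otimes> (inv b \<otimes> x \<otimes> b) \<otimes> c \<in> H)"
      using mem_conjugate_subgroup[OF N assms(3), of x] mN[of "inv b \<otimes> x \<otimes> b"] assms(3)
      by auto
    also have "\<dots> \<longleftrightarrow> (\<forall>c\<in>S. x \<in> carrier G \<and> inv c \<otimes> (inv b \<otimes> x \<otimes> b) \<otimes> c \<in> H)"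
      using S(2) by blast
    also have "\<dots> \<longleftrightarrow> (\<forall>c\<in>S. x \<in> conjugate_subgroup G (b \<otimes> c) H)"
    proof (rule ball_cong[OF refl])
      fix c assume "c \<in> S"
      then have c: "c \<in> carrier G" using S(3) by blast
      show "x \<in> carrier G \<and> inv c \<otimes> (inv b \<otimes> x \<otimes> b) \<otimes> c \<in> H \<longleftrightarrow>
          x \<in> conjugate_subgroup G (b \<otimes> c) H"
        using mem_conjugate_subgroup[OF assms(1) m_closed[OF assms(3) c]]
          conj_conj[OF _ assms(3) c] by auto
    qed
    finally show ?thesis by simp
  qed
  then have "conjugate_subgroup G b N =
      (\<Inter>c\<in>(\<lambda>c. b \<otimes> c) ` S. conjugate_subgroup G c H)" by (auto simp only: INT_simps image_image)
  moreover have "(\<lambda>c. b \<otimes> c) ` S \<subseteq> carrier G" using S(3) assms(3) by auto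
  ultimately show ?thesis using conjugate_meetsI[of "(\<lambda>c. b \<otimes> c) ` S" H] S(1,2) by simp
qed

section \<open>Subgroups covered by finitely many cosets\<close>

lemma rcoset_eq_iff:
  assumes "subgroup B G" "x \<in> carrier G" "y \<in> carrier G"
  shows "B #> x = B #> y \<longleftrightarrow> x \<otimes> inv y \<in> B"
proof
  assume "B #> x = B #> y"
  then have "x \<in> B #> y" using rcos_self[OF assms(2,1)] by simp
  then obtain b where b: "b \<in> B" "x = b \<otimes> y" unfolding r_coset_def by auto
  moreover have "b \<in> carrier G" using b assms(1) subgroup.subset by blast
  ultimately show "x \<otimes> inv y \<in> B" using assms by (simp add: m_assoc)
next
  assume "x \<otimes> inv y \<in> B"
  moreover have "x = (x \<otimes> inv y) \<otimes> y" using assms by (simp add: m_assoc)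
  ultimately have "x \<in> B #> y" unfolding r_coset_def by blast
  then show "B #> x = B #> y" using repr_independence[OF _ assms(3,1)] by simp
qed

text \<open>A finite invariant \<open>f\<close> that separates the cosets of \<open>B\<close> bounds their number; the closure
  properties below only have to exhibit such an invariant.\<close>

lemma coset_finite_criterion:
  assumes "subgroup B G" "H \<subseteq> carrier G" "finite (f ` H)"
    and "\<And>x y. x \<in> H \<Longrightarrow> y \<in> H \<Longrightarrow> f x = f y \<Longrightarrow> x \<otimes> inv y \<in> B"
  shows "coset_finite G H B"
  unfolding coset_finite_def
proof (rule finite_image_factor[OF assms(3)])
  fix x y assume xy: "x \<in> H" "y \<in> H" "f x = f y"
  have "x \<in> carrier G" "y \<in> carrier G" using xy(1,2) assms(2) by auto
  then show "B #> x = B #> y" using rcoset_eq_iff[OF assms(1)] assms(4)[OF xy] by simp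
qed

lemma coset_finite_mono:
  assumes "coset_finite G H B" "H' \<subseteq> H" "B \<subseteq> B'" "subgroup B G" "subgroup B' G"
    "H \<subseteq> carrier G"
  shows "coset_finite G H' B'"
proof (rule coset_finite_criterion[where f = "\<lambda>h. B #> h"])
  show "finite ((\<lambda>h. B #> h) ` H')"
    using assms(1,2) unfolding coset_finite_def by (meson finite_subset image_mono)
next
  fix x y assume xy: "x \<in> H'" "y \<in> H'" "B #> x = B #> y"
  have "x \<in> carrier G" "y \<in> carrier G" using xy(1,2) assms(2,6) by auto
  then show "x \<otimes> inv y \<in> B'" using rcoset_eq_iff[OF assms(4)] xy(3) assms(3) by auto
qed (use assms(2,5,6) in auto)

lemma coset_finite_INT:
  assumes "finite T" "T \<noteq> {}" "\<And>t. t \<in> T \<Longrightarrow> subgroup (B t) G"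
    "\<And>t. t \<in> T \<Longrightarrow> coset_finite G H (B t)" "H \<subseteq> carrier G"
  shows "coset_finite G H (\<Inter>t\<in>T. B t)"
proof (rule coset_finite_criterion[where f = "\<lambda>h. \<lambda>t\<in>T. B t #> h"])
  show "subgroup (\<Inter>t\<in>T. B t) G" by (rule subgroups_Inter) (use assms in auto)
  have "(\<lambda>h. \<lambda>t\<in>T. B t #> h) ` H \<subseteq> PiE T (\<lambda>t. (\<lambda>h. B t #> h) ` H)" by auto
  moreover have "finite (PiE T (\<lambda>t. (\<lambda>h. B t #> h) ` H))"
    using assms by (intro finite_PiE) (auto simp: coset_finite_def)
  ultimately show "finite ((\<lambda>h. \<lambda>t\<in>T. B t #> h) ` H)" by (rule finite_subset)
next
  fix x y assume xy: "x \<in> H" "y \<in> H" "(\<lambda>t\<in>T. B t #> x) = (\<lambda>t\<in>T. B t #> y)"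
  have "x \<otimes> inv y \<in> B t" if "t \<in> T" for t
  proof -
    have "B t #> x = B t #> y" using fun_cong[OF xy(3), of t] that by simp
    then show ?thesis using rcoset_eq_iff[OF assms(3)[OF that]] xy assms(5) by blast
  qed
  then show "x \<otimes> inv y \<in> (\<Inter>t\<in>T. B t)" by blast
qed (rule assms(5))

lemma coset_finite_Int:
  assumes "coset_finite G H B" "coset_finite G H B'" "subgroup B G" "subgroup B' G"
    "H \<subseteq> carrier G"
  shows "coset_finite G H (B \<inter> B')"
proof -
  have "coset_finite G H (\<Inter>t\<in>{B,B'}. t)" by (rule coset_finite_INT) (use assms in auto)
  then show ?thesis by simp
qed

lemma coset_finite_trans:
  assumes "coset_finite G H K" "coset_finite G K B" "subgroup K G" "subgroup B G"
    "H \<subseteq> carrier G"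
  shows "coset_finite G H B"
proof -
  define r where "r Y = (SOME h. h \<in> H \<and> K #> h = Y)" for Y
  \<comment> \<open>An element is recorded by its coset of \<open>K\<close> and, relative to a fixed representative of it, by the
    coset of \<open>B\<close> of the remaining factor in \<open>K\<close>.\<close>
  define f where "f h = (K #> h, B #> (h \<otimes> inv (r (K #> h))))" for h
  have r: "r (K #> h) \<in> H" "h \<otimes> inv (r (K #> h)) \<in> K" if "h \<in> H" for h
  proof -
    have 1: "r (K #> h) \<in> H \<and> K #> r (K #> h) = K #> h"
      unfolding r_def by (rule someI[of _ h]) (use that in auto)
    then show "r (K #> h) \<in> H" by blast
    then show "h \<otimes> inv (r (K #> h)) \<in> K"
      using 1 rcoset_eq_iff[OF assms(3), of h "r (K #> h)"] that assms(5) by auto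
  qed
  show ?thesis
  proof (rule coset_finite_criterion[where f = f])
    have "f ` H \<subseteq> (\<lambda>h. K #> h) ` H \<times> (\<lambda>h. B #> h) ` K" using r unfolding f_def by auto
    then show "finite (f ` H)" using assms(1,2) unfolding coset_finite_def
      by (meson finite_SigmaI finite_subset)
  next
    fix x y assume xy: "x \<in> H" "y \<in> H" "f x = f y"
    define z where "z = r (K #> x)"
    have c: "x \<in> carrier G" "y \<in> carrier G" "z \<in> carrier G"
      using xy r[OF xy(1)] assms(5) unfolding z_def by auto
    have "B #> (x \<otimes> inv z) = B #> (y \<otimes> inv z)" using xy(3) unfolding f_def z_def by auto
    then have "x \<otimes> inv z \<otimes> inv (y \<otimes> inv z) \<in> B"
      using rcoset_eq_iff[OF assms(4)] c by simp
    moreover have "x \<otimes> inv z \<otimes> inv (y \<otimes> inv z) = x \<otimes> inv y"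
      using c by (simp add: m_assoc inv_mult_group mult_inv_cancel)
    ultimately show "x \<otimes> inv y \<in> B" by simp
  qed (use assms in auto)
qed

lemma coset_finite_conjugate:
  assumes "coset_finite G H B" "subgroup H G" "subgroup B G" "c \<in> carrier G"
  shows "coset_finite G (conjugate_subgroup G c H) (conjugate_subgroup G c B)"
proof -
  have H: "H \<subseteq> carrier G" and B: "B \<subseteq> carrier G" using assms subgroup.subset by blast+
  note m = mem_conjugate_subgroup[OF H assms(4)] mem_conjugate_subgroup[OF B assms(4)]
  show ?thesis
  proof (rule coset_finite_criterion[where f = "\<lambda>x. B #> (inv c \<otimes> x \<otimes> c)"])
    have "(\<lambda>x. B #> (inv c \<otimes> x \<otimes> c)) ` conjugate_subgroup G c H \<subseteq> (\<lambda>h. B #> h) ` H"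
      using m by auto
    then show "finite ((\<lambda>x. B #> (inv c \<otimes> x \<otimes> c)) ` conjugate_subgroup G c H)"
      using assms(1) unfolding coset_finite_def by (rule finite_subset)
  next
    fix x y assume xy: "x \<in> conjugate_subgroup G c H" "y \<in> conjugate_subgroup G c H"
      "B #> (inv c \<otimes> x \<otimes> c) = B #> (inv c \<otimes> y \<otimes> c)"
    then have "(inv c \<otimes> x \<otimes> c) \<otimes> inv (inv c \<otimes> y \<otimes> c) \<in> B"
      using rcoset_eq_iff[OF assms(3)] m assms(4) by simp
    then show "x \<otimes> inv y \<in> conjugate_subgroup G c B"
      using xy m assms(4) by (simp add: conj_mult conj_inv)
  qed (use assms subgroup_conjugate m in auto)
qed

lemma finite_index_subgroup_iff:
  "finite_index_subgroup G K H \<longleftrightarrow>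
     subgroup K G \<and> subgroup H G \<and> K \<subseteq> H \<and> coset_finite G H K"
proof -
  have "rcosets\<^bsub>G\<lparr>carrier := H\<rparr>\<^esub> K = (\<lambda>h. K #> h) ` H"
    unfolding RCOSETS_def r_coset_def by auto
  then show ?thesis unfolding finite_index_subgroup_def coset_finite_def by simp
qed

lemma finite_index_Int_iff:
  assumes "subgroup H G" "subgroup B G"
  shows "finite_index_subgroup G (H \<inter> B) H \<longleftrightarrow> coset_finite G H B"
proof
  assume "finite_index_subgroup G (H \<inter> B) H"
  then have "subgroup (H \<inter> B) G" "coset_finite G H (H \<inter> B)"
    unfolding finite_index_subgroup_iff by blast+
  then show "coset_finite G H B"
    using coset_finite_mono[OF _ subset_refl Int_lower2 _ assms(2) subgroup.subset[OF assms(1)]]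
    by blast
next
  assume B: "coset_finite G H B"
  have H: "H \<subseteq> carrier G" by (rule subgroup.subset[OF assms(1)])
  have "coset_finite G H H"
    by (rule coset_finite_criterion[where f = "\<lambda>_. ()"])
      (use assms(1) H in \<open>auto simp: subgroup.m_closed subgroup.m_inv_closed\<close>)
  then have "coset_finite G H (H \<inter> B)" by (rule coset_finite_Int[OF _ B assms H])
  then show "finite_index_subgroup G (H \<inter> B) H" unfolding finite_index_subgroup_iff
    using assms subgroups_Inter_pair[OF assms] by simp
qed

lemma virtually_contained_iff:
  assumes "subgroup H G" "subgroup B G"
  shows "virtually_contained G H B \<longleftrightarrow> coset_finite G H B"
proof
  assume "virtually_contained G H B"
  then obtain K where K: "subgroup K G" "coset_finite G H K" "K \<subseteq> B"
    unfolding virtually_contained_def finite_index_subgroup_iff by blast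
  show "coset_finite G H B"
    by (rule coset_finite_mono[OF K(2) subset_refl K(3,1) assms(2) subgroup.subset[OF assms(1)]])
next
  assume "coset_finite G H B"
  then have "finite_index_subgroup G (H \<inter> B) H" by (simp add: finite_index_Int_iff[OF assms])
  then show "virtually_contained G H B" unfolding virtually_contained_def by blast
qed

section \<open>Commensurated subgroups\<close>

lemma commensurated_imp_coset_finite:
  assumes "commensurated G H" "c \<in> carrier G"
  shows "coset_finite G H (conjugate_subgroup G c H)"
proof -
  have H: "subgroup H G"
    and "finite_index_subgroup G (H \<inter> conjugate_subgroup G c H) H"
    using assms unfolding commensurated_def commensurable_def by blast+
  then show ?thesis by (simp add: finite_index_Int_iff[OF H subgroup_conjugate[OF H assms(2)]])
qed

lemma commensurated_coset_finite_conjugate: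
  assumes "commensurated G H" "coset_finite G H B" "subgroup B G" "c \<in> carrier G"
  shows "coset_finite G H (conjugate_subgroup G c B)"
proof -
  have H: "subgroup H G" using assms(1) unfolding commensurated_def by blast
  show ?thesis
    by (rule coset_finite_trans[OF commensurated_imp_coset_finite[OF assms(1,4)]
          coset_finite_conjugate[OF assms(2) H assms(3,4)]])
      (simp_all add: assms(3,4) subgroup_conjugate H subgroup.subset)
qed

lemma commensurated_coset_finite_meet:
  assumes "commensurated G H" "N \<in> conjugate_meets G H"
  shows "coset_finite G H N"
proof -
  have H: "subgroup H G" using assms(1) unfolding commensurated_def by blast
  obtain S where S: "finite S" "S \<noteq> {}" "S \<subseteq> carrier G"
    "N = (\<Inter>c\<in>S. conjugate_subgroup G c H)" using assms(2) by (rule conjugate_meetsE)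
  show ?thesis unfolding S(4)
    by (rule coset_finite_INT)
      (use S(1-3) H subgroup_conjugate commensurated_imp_coset_finite[OF assms(1)]
         subgroup.subset[OF H] in auto)
qed

section \<open>Walking along generators\<close>

text \<open>Products of generators are followed letter by letter through a set \<open>Y\<close> that need not be a subgroup,
  such as a product of two subgroups.\<close>

lemma generate_right_mult_closed:
  assumes y: "y \<in> generate G S"
    and S: "S \<subseteq> carrier G" and Y: "Y \<subseteq> carrier G"
    and step: "\<And>x s. x \<in> Y \<Longrightarrow> s \<in> S \<Longrightarrow> x \<otimes> s \<in> Y \<and> x \<otimes> inv s \<in> Y"
    and x: "x \<in> Y"
  shows "x \<otimes> y \<in> Y"
  using y x
proof (induction arbitrary: x rule: generate.induct)
  case one
  then show ?case using Y by auto
next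
  case (incl h)
  then show ?case using step by blast
next
  case (inv h)
  then show ?case using step by blast
next
  case (eng h1 h2)
  have "h1 \<in> carrier G" "h2 \<in> carrier G" "x \<in> carrier G"
    using eng generate_in_carrier[OF S] Y by auto
  then have "x \<otimes> (h1 \<otimes> h2) = x \<otimes> h1 \<otimes> h2" by (simp add: m_assoc)
  then show ?case using eng by simp
qed

section \<open>The core of a virtual container\<close>

text \<open>The conjugate of \<open>B\<close> by \<open>a \<in> A\<close> depends only on the coset of \<open>a\<close> modulo \<open>B\<close>, so the core
  \<open>D\<close> of \<open>B\<close> under \<open>A\<close> is an intersection over a finite set \<open>T\<close> and is still met by \<open>A\<close> in a
  subgroup of finite index. As \<open>A\<close> normalises \<open>D\<close>, the generated group is the product \<open>D A\<close>, which meets no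
  more cosets of \<open>D\<close> than \<open>A\<close> does. This replaces \<open>B\<close> by a group that contains all of \<open>A\<close>. The
  conjugators are taken in \<open>A\<close> and include \<open>\<one>\<close>, which gives \<open>D \<subseteq> B\<close>.\<close>

lemma core_virtually_contained:
  assumes A: "subgroup A G" and B: "subgroup B G" and fin: "coset_finite G A B"
  obtains T where "finite T" "T \<subseteq> A" "\<one> \<in> T"
    "coset_finite G (generate G (A \<union> (\<Inter>t\<in>T. conjugate_subgroup G t B))) B"
proof -
  interpret A: subgroup A G by fact
  interpret B: subgroup B G by fact
  note m = mem_conjugate_subgroup[OF B.subset]
  have "finite ((\<lambda>h. B #> h) ` (\<lambda>a. inv a) ` A)"
    by (rule finite_subset[OF _ fin[unfolded coset_finite_def]]) auto
  then have "finite ((\<lambda>a. B #> inv a) ` A)" by (simp add: image_image)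
  then have "finite ((\<lambda>a. conjugate_subgroup G a B) ` A)"
  proof (rule finite_image_factor)
    fix a a' assume a: "a \<in> A" "a' \<in> A" "B #> inv a = B #> inv a'"
    have c: "a \<in> carrier G" "a' \<in> carrier G" using a by auto
    have b: "inv a \<otimes> a' \<in> B" using rcoset_eq_iff[OF B, of "inv a" "inv a'"] a c by simp
    have "conjugate_subgroup G a' B = conjugate_subgroup G (a \<otimes> (inv a \<otimes> a')) B"
      using c by (simp add: mult_inv_cancel)
    also have "\<dots> = conjugate_subgroup G a (conjugate_subgroup G (inv a \<otimes> a') B)"
      using c m conj_conj subgroup.subset[OF subgroup_conjugate[OF B, of "inv a \<otimes> a'"]]
      by (auto simp: mem_conjugate_subgroup)
    also have "\<dots> = conjugate_subgroup G a B" using conjugate_self[OF B b] by simp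
    finally show "conjugate_subgroup G a B = conjugate_subgroup G a' B" by simp
  qed
  then obtain T0 where T0: "finite T0" "T0 \<subseteq> A"
      "(\<lambda>a. conjugate_subgroup G a B) ` A = (\<lambda>a. conjugate_subgroup G a B) ` T0"
    by (metis finite_subset_image subset_refl)
  define T where "T = insert \<one> T0"
  define D where "D = (\<Inter>t\<in>T. conjugate_subgroup G t B)"
  have T: "finite T" "T \<subseteq> A" "\<one> \<in> T" using T0 unfolding T_def by auto
  have "(\<lambda>a. conjugate_subgroup G a B) ` T = (\<lambda>a. conjugate_subgroup G a B) ` A"
    using T0(3) imageI[OF A.one_closed, of "\<lambda>a. conjugate_subgroup G a B"]
    unfolding T_def by (simp add: insert_absorb)
  then have D: "D = (\<Inter>a\<in>A. conjugate_subgroup G a B)" unfolding D_def by simp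
  have DG: "subgroup D G" unfolding D_def
    by (rule subgroup_Inter_conjugates) (use B T in auto)
  interpret D: subgroup D G by fact
  have DB: "D \<subseteq> B" unfolding D using conjugate_one[OF B.subset] A.one_closed by fastforce
  have fT: "coset_finite G A (conjugate_subgroup G t B)" if "t \<in> T" for t
    using coset_finite_conjugate[OF fin A B, of t] conjugate_self[OF A, of t] T that by auto
  have finD: "coset_finite G A D" unfolding D_def
    by (rule coset_finite_INT) (use T fT subgroup_conjugate[OF B] in auto)
  have norm: "a \<otimes> d \<otimes> inv a \<in> D" if "a \<in> A" "d \<in> D" for a d
  proof -
    have "a \<otimes> d \<otimes> inv a \<in> conjugate_subgroup G a' B" if a': "a' \<in> A" for a'
    proof -
      have c: "a \<in> carrier G" "d \<in> carrier G" "a' \<in> carrier G" using \<open>a \<in> A\<close> \<open>d \<in> D\<close> a' by auto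
      have "d \<in> conjugate_subgroup G (inv a \<otimes> a') B"
        using \<open>d \<in> D\<close> \<open>a \<in> A\<close> a' unfolding D by auto
      then have "inv (inv a \<otimes> a') \<otimes> d \<otimes> (inv a \<otimes> a') \<in> B" using m c by simp
      then have "inv a' \<otimes> (a \<otimes> d \<otimes> inv a) \<otimes> a' \<in> B"
        using conj_conj[of d "inv a" a'] c by simp
      then show ?thesis using m c by simp
    qed
    then show ?thesis unfolding D by blast
  qed
  \<comment> \<open>The product \<open>D A\<close> is already the generated group.\<close>
  define Y where "Y = {d \<otimes> a | d a. d \<in> D \<and> a \<in> A}"
  have YG: "Y \<subseteq> carrier G" unfolding Y_def by auto
  have gen: "generate G (A \<union> D) \<subseteq> Y"
  proof
    fix y assume y: "y \<in> generate G (A \<union> D)"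
    have AD: "A \<union> D \<subseteq> carrier G" by auto
    have mul: "x \<otimes> s \<in> Y" if x: "x \<in> Y" and s: "s \<in> A \<union> D" for x s
    proof -
      obtain d a where da: "x = d \<otimes> a" "d \<in> D" "a \<in> A" using x unfolding Y_def by blast
      have c: "d \<in> carrier G" "a \<in> carrier G" "s \<in> carrier G" using da s by auto
      show ?thesis
      proof (cases "s \<in> A")
        case True
        have "x \<otimes> s = d \<otimes> (a \<otimes> s)" using da c by (simp add: m_assoc)
        then show ?thesis using True da unfolding Y_def by blast
      next
        case False
        have "x \<otimes> s = (d \<otimes> (a \<otimes> s \<otimes> inv a)) \<otimes> a" using da c by (simp add: m_assoc)
        moreover have "a \<otimes> s \<otimes> inv a \<in> D" using norm da s False by blast
        ultimately show ?thesis using da unfolding Y_def by blast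
      qed
    qed
    have "\<one> \<otimes> \<one> \<in> Y" unfolding Y_def using D.one_closed A.one_closed by blast
    then have "\<one> \<in> Y" by simp
    moreover have "x \<otimes> s \<in> Y \<and> x \<otimes> inv s \<in> Y" if "x \<in> Y" "s \<in> A \<union> D" for x s
      using mul[OF that(1)] that(2) by auto
    ultimately have "\<one> \<otimes> y \<in> Y" using generate_right_mult_closed[OF y AD YG] by blast
    then show "y \<in> Y" using y generate_in_carrier[OF AD] by simp
  qed
  have "D #> x \<in> (\<lambda>h. D #> h) ` A" if x: "x \<in> Y" for x
  proof -
    obtain d a where da: "x = d \<otimes> a" "d \<in> D" "a \<in> A" using x unfolding Y_def by blast
    then have "D #> x = D #> a" using rcoset_eq_iff[OF DG, of x a] by (simp add: m_assoc)
    then show ?thesis using da by blast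
  qed
  then have "(\<lambda>h. D #> h) ` generate G (A \<union> D) \<subseteq> (\<lambda>h. D #> h) ` A" using gen by blast
  then have "coset_finite G (generate G (A \<union> D)) D"
    using finD unfolding coset_finite_def by (rule finite_subset)
  then have "coset_finite G (generate G (A \<union> D)) B"
    by (rule coset_finite_mono[OF _ subset_refl DB DG B])
      (intro generate_incl, auto)
  then show thesis using that T unfolding D_def by blast
qed

section \<open>Stable members of a family and density\<close>

text \<open>Take a member of the family whose image meets the fewest cosets of \<open>K\<close>: passing to a smaller member can
  then lose none of them. With \<open>g\<close> the identity this finds a neighbourhood inside the closure of \<open>K\<close>; with
  \<open>g\<close> the trace of the join on \<open>A2\<close> it finds a join whose trace modulo \<open>K\<close> is stable.\<close>

lemma least_cosets_stable:
  assumes K: "coset_finite G H K"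
    and ne: "\<F> \<noteq> {}"
    and sub: "\<And>M. M \<in> \<F> \<Longrightarrow> g M \<subseteq> H"
    and mono: "\<And>M M'. M \<in> \<F> \<Longrightarrow> M' \<in> \<F> \<Longrightarrow> M' \<subseteq> M \<Longrightarrow> g M' \<subseteq> g M"
  obtains M where "M \<in> \<F>"
    "\<And>M' x. M' \<in> \<F> \<Longrightarrow> M' \<subseteq> M \<Longrightarrow> x \<in> g M \<Longrightarrow> \<exists>y\<in>g M'. K #> x = K #> y"
proof -
  define \<mu> where "\<mu> M = card ((\<lambda>x. K #> x) ` g M)" for M
  obtain M where M: "M \<in> \<F>" "\<And>M'. M' \<in> \<F> \<Longrightarrow> \<mu> M \<le> \<mu> M'"
    using ex_has_least_nat[of "\<lambda>M. M \<in> \<F>" _ \<mu>] ne by blast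
  have "\<exists>y\<in>g M'. K #> x = K #> y" if "M' \<in> \<F>" "M' \<subseteq> M" "x \<in> g M" for M' x
  proof -
    have fin: "finite ((\<lambda>x. K #> x) ` g M)"
      using K sub[OF M(1)] unfolding coset_finite_def by (meson finite_subset image_mono)
    have "(\<lambda>x. K #> x) ` g M' = (\<lambda>x. K #> x) ` g M"
    proof (rule card_seteq[OF fin])
      show "(\<lambda>x. K #> x) ` g M' \<subseteq> (\<lambda>x. K #> x) ` g M" using mono[OF M(1) that(1,2)] by blast
      show "card ((\<lambda>x. K #> x) ` g M) \<le> card ((\<lambda>x. K #> x) ` g M')"
        using M(2)[OF that(1)] unfolding \<mu>_def .
    qed
    then show ?thesis using that(3) by (metis (no_types, lifting) imageE imageI)
  qed
  then show thesis using that M(1) by blast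
qed

text \<open>The hypothesis \<open>dense\<close> places \<open>M\<close> in the closure of \<open>B\<close> for the topology with neighbourhood base
  \<open>conjugate_meets G H\<close>, and the closure of a subgroup is a subgroup. The error made in one factor has to be
  moved past the element \<open>b \<in> B\<close> in front of it, which conjugates it by \<open>b\<close>. As \<open>b\<close> is known before the next
  factor is approximated, the error there can be taken in a conjugate neighbourhood.\<close>

lemma generate_dense:
  assumes H: "subgroup H G" and A: "A \<subseteq> B" and B: "subgroup B G"
    and M: "M \<subseteq> carrier G" "\<And>m. m \<in> M \<Longrightarrow> inv m \<in> M"
    and dense: "\<And>m N. m \<in> M \<Longrightarrow> N \<in> conjugate_meets G H \<Longrightarrow> \<exists>n\<in>N. \<exists>b\<in>B. m = n \<otimes> b"
    and y: "y \<in> generate G (A \<union> M)" and N: "N \<in> conjugate_meets G H"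
  shows "\<exists>n\<in>N. \<exists>b\<in>B. y = n \<otimes> b"
proof -
  interpret B: subgroup B G by fact
  have HG: "H \<subseteq> carrier G" using H subgroup.subset by blast
  define Y where
    "Y = {x \<in> carrier G. \<forall>N\<in>conjugate_meets G H. \<exists>n\<in>N. \<exists>b\<in>B. x = n \<otimes> b}"
  have AM: "A \<union> M \<subseteq> carrier G" using A M(1) B.subset by blast
  have YG: "Y \<subseteq> carrier G" unfolding Y_def by blast
  have mulB: "x \<otimes> s \<in> Y" if x: "x \<in> Y" and s: "s \<in> B" for x s
  proof -
    have "\<exists>n\<in>N. \<exists>b\<in>B. x \<otimes> s = n \<otimes> b" if N: "N \<in> conjugate_meets G H" for N
    proof -
      obtain n b where nb: "n \<in> N" "b \<in> B" "x = n \<otimes> b" using x N unfolding Y_def by blast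
      have "n \<in> carrier G" using nb N conjugate_meets_subgroup[OF H] subgroup.subset by blast
      then have "x \<otimes> s = n \<otimes> (b \<otimes> s)" using nb s by (simp add: m_assoc)
      then show ?thesis using nb s by blast
    qed
    then show ?thesis using x s unfolding Y_def by auto
  qed
  have mulM: "x \<otimes> s \<in> Y" if x: "x \<in> Y" and s: "s \<in> M" for x s
  proof -
    have "\<exists>n\<in>N. \<exists>b\<in>B. x \<otimes> s = n \<otimes> b" if N: "N \<in> conjugate_meets G H" for N
    proof -
      interpret N: subgroup N G using N conjugate_meets_subgroup[OF H] by blast
      obtain n b where nb: "n \<in> N" "b \<in> B" "x = n \<otimes> b" using x N unfolding Y_def by blast
      have b: "b \<in> carrier G" using nb by auto
      \<comment> \<open>Approximating \<open>s\<close> up to this neighbourhood leaves an error in \<open>N\<close> after moving it past \<open>b\<close>.\<close>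
      have "conjugate_subgroup G (inv b) N \<in> conjugate_meets G H"
        using conjugate_meets_conjugate[OF HG N] b by simp
      then obtain n' b' where n': "n' \<in> conjugate_subgroup G (inv b) N" "b' \<in> B" "s = n' \<otimes> b'"
        using dense[OF s] by blast
      have n'c: "n' \<in> carrier G" "b \<otimes> n' \<otimes> inv b \<in> N"
        using n'(1) mem_conjugate_subgroup[OF N.subset, of "inv b"] b by auto
      have "x \<otimes> s = (n \<otimes> (b \<otimes> n' \<otimes> inv b)) \<otimes> (b \<otimes> b')"
        using nb n' n'c b by (simp add: m_assoc mult_inv_cancel)
      then show ?thesis using nb n' n'c by blast
    qed
    then show ?thesis using x s M unfolding Y_def by auto
  qed
  have "x \<otimes> s \<in> Y \<and> x \<otimes> inv s \<in> Y" if "x \<in> Y" "s \<in> A \<union> M" for x s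
    using that mulB[OF that(1)] mulM[OF that(1)] A M(2) by blast
  moreover have "\<one> \<in> Y"
  proof -
    have "\<one> \<in> N" if "N \<in> conjugate_meets G H" for N
      using conjugate_meets_subgroup[OF H that] subgroup.one_closed by blast
    then show ?thesis unfolding Y_def using B.one_closed
      by (auto intro!: bexI[of _ "\<one>"])
  qed
  ultimately have "\<one> \<otimes> y \<in> Y" using generate_right_mult_closed[OF y AM YG] by blast
  then have "y \<in> Y" using generate_in_carrier[OF AM y] by simp
  then show ?thesis using N unfolding Y_def by blast
qed

section \<open>Stability of the join under passing to finite index\<close>

text \<open>The product \<open>B A2\<close> is the preimage of the \<open>B\<close>-orbit of the base point among the cosets of \<open>A2\<close>. By
  \<open>dense\<close>, an element \<open>u\<close> of \<open>A2\<close> in the join can be replaced by \<open>b' \<in> B\<close> up to a factor \<open>k \<in> K\<close>, and then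
  \<open>u f = (b' f) (f\<^sup>-\<^sup>1 k f)\<close> with \<open>b' f \<in> B\<close> and \<open>f\<^sup>-\<^sup>1 k f \<in> A2\<close>. So a step along a generator never leaves
  \<open>B A2\<close>, the whole join lies in \<open>B A2\<close>, and it meets no more cosets of \<open>B\<close> than \<open>A2\<close> does.\<close>

lemma join_coset_finite_if_dense:
  assumes A1: "subgroup A1 G" and A2: "subgroup A2 G"
    and F: "F \<subseteq> carrier G" "A1 = generate G ((A1 \<inter> A2) \<union> F)"
    and M: "M \<subseteq> A2" "subgroup M G" and B: "subgroup B G" "A1 \<subseteq> B" "B \<subseteq> generate G (A1 \<union> M)"
    and fin: "coset_finite G A2 B"
    and K: "\<And>k f. k \<in> K \<Longrightarrow> f \<in> F \<Longrightarrow> inv f \<otimes> k \<otimes> f \<in> A2 \<and> f \<otimes> k \<otimes> inv f \<in> A2"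
      "K \<subseteq> carrier G"
    and dense: "\<And>u. u \<in> generate G (A1 \<union> M) \<Longrightarrow> u \<in> A2 \<Longrightarrow> \<exists>b\<in>B. \<exists>k\<in>K. u = b \<otimes> k"
  shows "coset_finite G (generate G (A1 \<union> M)) B"
proof -
  interpret A1: subgroup A1 G by fact
  interpret A2: subgroup A2 G by fact
  interpret M: subgroup M G by fact
  interpret B: subgroup B G by fact
  define A where "A = generate G (A1 \<union> M)"
  have AM: "A1 \<union> M \<subseteq> carrier G" by auto
  have AG: "subgroup A G" unfolding A_def by (rule generate_is_subgroup[OF AM])
  interpret A: subgroup A G by fact
  have AA: "A1 \<subseteq> A" "M \<subseteq> A" unfolding A_def by (auto intro: generate.incl)
  have FA1: "F \<subseteq> A1" by (subst F(2)) (auto intro: generate.incl)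
  \<comment> \<open>Membership in \<open>A\<close> is kept, since \<open>dense\<close> can only be applied to elements of \<open>A \<inter> A2\<close>.\<close>
  define Y where "Y = {x \<in> A. \<exists>b\<in>B. \<exists>u\<in>A2. x = b \<otimes> u}"
  have YG: "Y \<subseteq> carrier G" unfolding Y_def by auto
  have mul2: "x \<otimes> s \<in> Y" if x: "x \<in> Y" and s: "s \<in> A \<inter> A2" for x s
  proof -
    obtain b u where bu: "x \<in> A" "b \<in> B" "u \<in> A2" "x = b \<otimes> u" using x unfolding Y_def by blast
    then have "x \<otimes> s = b \<otimes> (u \<otimes> s)" using s by (simp add: m_assoc)
    then show ?thesis unfolding Y_def using bu s by blast
  qed
  have mulF: "x \<otimes> s \<in> Y" if x: "x \<in> Y" and s: "s \<in> A1"
    and sK: "\<And>k. k \<in> K \<Longrightarrow> inv s \<otimes> k \<otimes> s \<in> A2" for x s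
  proof -
    obtain b u where bu: "x \<in> A" "b \<in> B" "u \<in> A2" "x = b \<otimes> u" using x unfolding Y_def by blast
    have c: "b \<in> carrier G" "u \<in> carrier G" "s \<in> carrier G" using bu s by auto
    have bA: "b \<in> A" using bu(2) B(3) unfolding A_def by blast
    have "inv b \<otimes> x = u" using bu c by (simp add: m_assoc[symmetric])
    then have "u \<in> A" using A.m_closed[OF A.m_inv_closed[OF bA] bu(1)] by simp
    then obtain b' k where bk: "b' \<in> B" "k \<in> K" "u = b' \<otimes> k"
      using dense bu(3) unfolding A_def by blast
    have kc: "k \<in> carrier G" "b' \<in> carrier G" using bk K(2) by auto
    have "x \<otimes> s = (b \<otimes> b' \<otimes> s) \<otimes> (inv s \<otimes> k \<otimes> s)"
      using bu bk c kc by (simp add: m_assoc mult_inv_cancel)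
    moreover have "b \<otimes> b' \<otimes> s \<in> B" using bu bk s B(2) by auto
    moreover have "x \<otimes> s \<in> A" using bu s AA by auto
    ultimately show ?thesis unfolding Y_def using sK[OF bk(2)] by blast
  qed
  have step1: "x \<otimes> s \<in> Y \<and> x \<otimes> inv s \<in> Y" if x: "x \<in> Y" and s: "s \<in> (A1 \<inter> A2) \<union> F" for x s
  proof (cases "s \<in> A1 \<inter> A2")
    case True
    then show ?thesis using mul2[OF x] AA by auto
  next
    case False
    then have sF: "s \<in> F" "s \<in> A1" using s FA1 by auto
    then show ?thesis using mulF[OF x, of s] mulF[OF x, of "inv s"] K(1) by auto
  qed
  have mul1: "x \<otimes> s \<in> Y" if x: "x \<in> Y" and s: "s \<in> A1" for x s
  proof (rule generate_right_mult_closed[OF _ _ YG step1 x])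
    show "s \<in> generate G ((A1 \<inter> A2) \<union> F)" using s F(2) by blast
    show "(A1 \<inter> A2) \<union> F \<subseteq> carrier G" using F(1) by auto
  qed
  have step2: "x \<otimes> s \<in> Y \<and> x \<otimes> inv s \<in> Y" if x: "x \<in> Y" and s: "s \<in> A1 \<union> M" for x s
  proof (cases "s \<in> A1")
    case True
    then show ?thesis using mul1[OF x] by auto
  next
    case False
    then have "s \<in> M" using s by blast
    then have "s \<in> A \<inter> A2" "inv s \<in> A \<inter> A2" using AA M by auto
    then show ?thesis using mul2[OF x] by blast
  qed
  have one: "\<one> \<in> Y" unfolding Y_def using A.one_closed B.one_closed A2.one_closed
    by (auto intro!: bexI[of _ "\<one>"])
  have "B #> y \<in> (\<lambda>h. B #> h) ` A2" if y: "y \<in> A" for y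
  proof -
    have "\<one> \<otimes> y \<in> Y"
      by (rule generate_right_mult_closed[OF y[unfolded A_def] AM YG step2 one])
    then obtain b u where bu: "b \<in> B" "u \<in> A2" "y = b \<otimes> u" using y unfolding Y_def by auto
    then have "B #> y = B #> u" using rcoset_eq_iff[OF B(1), of y u] by (simp add: m_assoc)
    then show ?thesis using bu by blast
  qed
  then have "(\<lambda>h. B #> h) ` A \<subseteq> (\<lambda>h. B #> h) ` A2" by blast
  then show ?thesis using fin unfolding coset_finite_def A_def by (rule finite_subset)
qed

text \<open>The subgroup \<open>M\<close> is minimal for the trace of \<open>\<langle>A1, M\<rangle>\<close> on \<open>A2\<close> modulo \<open>K\<close>, where \<open>K\<close> fixes the
  cosets \<open>f A2\<close> and \<open>f\<^sup>-\<^sup>1 A2\<close> for the finitely many additional generators \<open>f\<close> of \<open>A1\<close>. An arbitrary \<open>L\<close> is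
  compared with \<open>M\<close> through an intersection of conjugates \<open>M1 \<subseteq> M\<close> contained in the closure of \<open>L\<close>.\<close>

lemma commensurated_join_stable:
  assumes A1: "subgroup A1 G" and comm: "commensurated G A2"
    and fg: "finitely_generated_over G A1 (A1 \<inter> A2)"
  obtains M where "M \<in> conjugate_meets G A2" "M \<subseteq> A2"
    "\<And>L. subgroup L G \<Longrightarrow> L \<subseteq> M \<Longrightarrow> coset_finite G A2 L \<Longrightarrow>
       coset_finite G (generate G (A1 \<union> M)) (generate G (A1 \<union> L))"
proof -
  have A2: "subgroup A2 G" using comm unfolding commensurated_def by blast
  interpret A1: subgroup A1 G by fact
  interpret A2: subgroup A2 G by fact
  obtain F where F: "finite F" "F \<subseteq> carrier G" "A1 = generate G ((A1 \<inter> A2) \<union> F)"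
    using fg unfolding finitely_generated_over_def by blast
  \<comment> \<open>The conjugator \<open>\<one>\<close> keeps \<open>S\<close> nonempty when \<open>F\<close> is empty.\<close>
  define S where "S = insert \<one> (F \<union> (\<lambda>f. inv f) ` F)"
  define K where "K = (\<Inter>c\<in>S. conjugate_subgroup G c A2)"
  have S: "finite S" "S \<noteq> {}" "S \<subseteq> carrier G" using F unfolding S_def by auto
  have KL: "K \<in> conjugate_meets G A2" unfolding K_def using S by (rule conjugate_meetsI)
  have KG: "subgroup K G" using KL conjugate_meets_subgroup[OF A2] by blast
  interpret K: subgroup K G by fact
  have Kf: "inv f \<otimes> k \<otimes> f \<in> A2 \<and> f \<otimes> k \<otimes> inv f \<in> A2" if "k \<in> K" "f \<in> F" for k f
  proof -
    have f: "f \<in> carrier G" using that F by auto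
    have "k \<in> conjugate_subgroup G f A2" "k \<in> conjugate_subgroup G (inv f) A2"
      using that unfolding K_def S_def by auto
    then show ?thesis
      using mem_conjugate_subgroup[OF A2.subset, of f] f
        mem_conjugate_subgroup[OF A2.subset, of "inv f"] by simp
  qed
  define \<F> where "\<F> = {N \<in> conjugate_meets G A2. N \<subseteq> A2}"
  have FG: "subgroup N G" if "N \<in> \<F>" for N
    using that conjugate_meets_subgroup[OF A2] unfolding \<F>_def by blast
  have ne: "\<F> \<noteq> {}" using conjugate_meets_self[OF A2.subset] unfolding \<F>_def by blast
  have gmono: "generate G (A1 \<union> M') \<subseteq> generate G (A1 \<union> M)" if "M' \<subseteq> M" for M M'
    by (rule mono_generate) (use that in auto)
  obtain M where M: "M \<in> \<F>" and Mmin: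
    "\<And>M' x. M' \<in> \<F> \<Longrightarrow> M' \<subseteq> M \<Longrightarrow> x \<in> generate G (A1 \<union> M) \<inter> A2 \<Longrightarrow>
       \<exists>y\<in>generate G (A1 \<union> M') \<inter> A2. K #> x = K #> y"
    by (rule least_cosets_stable[OF commensurated_coset_finite_meet[OF comm KL] ne,
          of "\<lambda>M. generate G (A1 \<union> M) \<inter> A2"]) (use gmono in blast)+
  have MG: "subgroup M G" using FG M by blast
  have M2: "M \<in> conjugate_meets G A2" "M \<subseteq> A2" using M unfolding \<F>_def by auto
  show thesis
  proof (rule that[OF M2])
    fix L assume L: "subgroup L G" "L \<subseteq> M" "coset_finite G A2 L"
    interpret L: subgroup L G by fact
    define B where "B = generate G (A1 \<union> L)"
    have AL: "A1 \<union> L \<subseteq> carrier G" by auto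
    have BG: "subgroup B G" unfolding B_def by (rule generate_is_subgroup[OF AL])
    interpret B: subgroup B G by fact
    have LB: "L \<subseteq> B" "A1 \<subseteq> B" unfolding B_def by (auto intro: generate.incl)
    \<comment> \<open>\<open>M0\<close> meets the fewest cosets of \<open>L\<close>. Any smaller neighbourhood meets the same ones, that is,
      \<open>M0\<close> lies in the closure of \<open>L\<close>.\<close>
    obtain M0 where M0: "M0 \<in> \<F>" and M0min:
      "\<And>M' x. M' \<in> \<F> \<Longrightarrow> M' \<subseteq> M0 \<Longrightarrow> x \<in> M0 \<Longrightarrow> \<exists>y\<in>M'. L #> x = L #> y"
      by (rule least_cosets_stable[OF L(3) ne, of "\<lambda>M. M"]) (auto simp: \<F>_def)
    define M1 where "M1 = M0 \<inter> M"
    have M1: "M1 \<in> \<F>" using M M0 conjugate_meets_Int unfolding M1_def \<F>_def by blast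
    interpret M1: subgroup M1 G using FG M1 by blast
    have dense: "\<exists>n\<in>N. \<exists>b\<in>B. m = n \<otimes> b" if m: "m \<in> M1" and N: "N \<in> conjugate_meets G A2"
      for m N
    proof -
      interpret N: subgroup N G using conjugate_meets_subgroup[OF A2 N] .
      have "N \<inter> M0 \<in> \<F>" using N M0 conjugate_meets_Int unfolding \<F>_def by blast
      moreover have "inv m \<in> M0" using M1.m_inv_closed[OF m] unfolding M1_def by blast
      ultimately obtain y where y: "y \<in> N" "L #> inv m = L #> y"
        using M0min[of "N \<inter> M0" "inv m"] by blast
      have c: "m \<in> carrier G" "y \<in> carrier G" using m y by auto
      have l: "inv m \<otimes> inv y \<in> L" using rcoset_eq_iff[OF L(1), of "inv m" y] y c by simp
      have "m = inv y \<otimes> inv (inv m \<otimes> inv y)"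
        using c by (simp add: inv_mult_group m_assoc[symmetric])
      moreover have "inv (inv m \<otimes> inv y) \<in> B" using l LB by blast
      ultimately show ?thesis using y(1) by blast
    qed
    have denseK: "\<exists>b\<in>B. \<exists>k\<in>K. u = b \<otimes> k" if u: "u \<in> generate G (A1 \<union> M)" "u \<in> A2" for u
    proof -
      interpret A: subgroup "generate G (A1 \<union> M)" G
        by (rule generate_is_subgroup) (use M(1) subgroup.subset[OF MG] in auto)
      \<comment> \<open>Right cosets of \<open>K\<close> put the error in \<open>K\<close> on the left; the inverse moves it to the right.\<close>
      have "inv u \<in> generate G (A1 \<union> M) \<inter> A2" using u by blast
      moreover have "M1 \<subseteq> M" unfolding M1_def by blast
      ultimately obtain v where v: "v \<in> generate G (A1 \<union> M1)" "v \<in> A2" "K #> inv u = K #> v"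
        using Mmin[OF M1] by blast
      obtain k b where kb: "k \<in> K" "b \<in> B" "v = k \<otimes> b"
        using generate_dense[OF A2 LB(2) BG M1.subset M1.m_inv_closed dense v(1) KL] by blast
      have c: "u \<in> carrier G" "k \<in> carrier G" "b \<in> carrier G" using u kb by auto
      have "inv u \<otimes> inv v \<in> K" using rcoset_eq_iff[OF KG, of "inv u" v] v c kb by simp
      then have "inv u \<otimes> inv v \<otimes> k \<in> K" using kb by blast
      then have "inv (inv u \<otimes> inv v \<otimes> k) \<in> K" by blast
      moreover have "u = inv b \<otimes> inv (inv u \<otimes> inv v \<otimes> k)"
        using c kb by (simp add: inv_mult_group m_assoc mult_inv_cancel)
      ultimately show ?thesis using kb by blast
    qed
    have finB: "coset_finite G A2 B"
      by (rule coset_finite_mono[OF L(3) subset_refl LB(1) L(1) BG A2.subset])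
    show "coset_finite G (generate G (A1 \<union> M)) (generate G (A1 \<union> L))"
      using join_coset_finite_if_dense[OF A1 A2 F(2,3) M2(2) MG BG LB(2) _ finB Kf K.subset denseK]
        gmono[OF L(2)] unfolding B_def by blast
  qed
qed

section \<open>The least virtual container\<close>

text \<open>The core \<open>D\<close> of \<open>B\<close> under \<open>A1\<close> still meets \<open>A2\<close> in finite index, because \<open>A2\<close> is
  commensurated. Stability of the join therefore applies to \<open>M \<inter> D\<close>, and \<open>\<langle>A1, M \<inter> D\<rangle>\<close> lies in
  \<open>\<langle>A1, D\<rangle>\<close>, which is virtually contained in \<open>B\<close>.\<close>

lemma commensurated_join_virtually_least:
  assumes A1: "subgroup A1 G" and comm: "commensurated G A2"
    and fg: "finitely_generated_over G A1 (A1 \<inter> A2)"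
  obtains M where "M \<in> conjugate_meets G A2" "M \<subseteq> A2"
    "\<And>B. subgroup B G \<Longrightarrow> coset_finite G A1 B \<Longrightarrow> coset_finite G A2 B \<Longrightarrow>
       coset_finite G (generate G (A1 \<union> M)) B"
proof -
  have A2: "subgroup A2 G" using comm unfolding commensurated_def by blast
  interpret A1: subgroup A1 G by fact
  interpret A2: subgroup A2 G by fact
  obtain M where M: "M \<in> conjugate_meets G A2" "M \<subseteq> A2" and
    stable: "\<And>L. subgroup L G \<Longrightarrow> L \<subseteq> M \<Longrightarrow> coset_finite G A2 L \<Longrightarrow>
       coset_finite G (generate G (A1 \<union> M)) (generate G (A1 \<union> L))"
    using commensurated_join_stable[OF assms] by blast
  interpret M: subgroup M G using conjugate_meets_subgroup[OF A2 M(1)] .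
  show thesis
  proof (rule that[OF M])
    fix B assume B: "subgroup B G" "coset_finite G A1 B" "coset_finite G A2 B"
    obtain T where T: "finite T" "T \<subseteq> A1" "\<one> \<in> T" and
      fin: "coset_finite G (generate G (A1 \<union> (\<Inter>t\<in>T. conjugate_subgroup G t B))) B"
      using core_virtually_contained[OF A1 B(1,2)] by blast
    define D where "D = (\<Inter>t\<in>T. conjugate_subgroup G t B)"
    have TG: "T \<subseteq> carrier G" "T \<noteq> {}" using T by auto
    have DG: "subgroup D G" unfolding D_def
      by (rule subgroup_Inter_conjugates[OF B(1) TG(2,1)])
    interpret D: subgroup D G by fact
    have fD: "coset_finite G A2 D" unfolding D_def
    proof (rule coset_finite_INT[OF T(1) TG(2)])
      fix t assume "t \<in> T"
      then have t: "t \<in> carrier G" using TG by auto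
      show "subgroup (conjugate_subgroup G t B) G" by (rule subgroup_conjugate[OF B(1) t])
      show "coset_finite G A2 (conjugate_subgroup G t B)"
        by (rule commensurated_coset_finite_conjugate[OF comm B(3,1) t])
    qed auto
    have L: "subgroup (M \<inter> D) G" using subgroups_Inter_pair[OF M.subgroup_axioms DG] .
    have fL: "coset_finite G A2 (M \<inter> D)"
      by (rule coset_finite_Int[OF commensurated_coset_finite_meet[OF comm M(1)] fD
            M.subgroup_axioms DG A2.subset])
    have GL: "subgroup (generate G (A1 \<union> (M \<inter> D))) G" by (rule generate_is_subgroup) auto
    have GD: "generate G (A1 \<union> D) \<subseteq> carrier G" by (rule generate_incl) auto
    have GM: "generate G (A1 \<union> M) \<subseteq> carrier G" by (rule generate_incl) auto
    have "generate G (A1 \<union> (M \<inter> D)) \<subseteq> generate G (A1 \<union> D)" by (rule mono_generate) auto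
    then have fin': "coset_finite G (generate G (A1 \<union> (M \<inter> D))) B"
      by (rule coset_finite_mono[OF fin[folded D_def] _ subset_refl B(1,1) GD])
    show "coset_finite G (generate G (A1 \<union> M)) B"
      by (rule coset_finite_trans[OF stable[OF L _ fL] fin' GL B(1) GM]) auto
  qed
qed

text \<open>Exchanging the roles of \<open>A1\<close> and \<open>A2\<close> gives a least container \<open>E\<close> generated by \<open>A2\<close> and a
  subgroup of \<open>A1\<close>, which has the wrong shape. Taking the core of \<open>E\<close> under \<open>A1\<close> restores all of \<open>A1\<close>:
  conjugating \<open>A2 \<subseteq> E\<close> by the same finite set gives \<open>M\<close> inside this core, hence \<open>\<langle>A1, M\<rangle>\<close>
  is virtually contained in \<open>E\<close>.\<close>

lemma commensurated_join_virtually_least_symmetric: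
  assumes comm1: "commensurated G A1" and comm2: "commensurated G A2"
    and fg: "finitely_generated_over G A2 (A1 \<inter> A2)"
  obtains M where "M \<in> conjugate_meets G A2" "M \<subseteq> A2"
    "\<And>B. subgroup B G \<Longrightarrow> coset_finite G A1 B \<Longrightarrow> coset_finite G A2 B \<Longrightarrow>
       coset_finite G (generate G (A1 \<union> M)) B"
proof -
  have A1: "subgroup A1 G" and A2: "subgroup A2 G"
    using comm1 comm2 unfolding commensurated_def by blast+
  interpret A1: subgroup A1 G by fact
  interpret A2: subgroup A2 G by fact
  have fg': "finitely_generated_over G A2 (A2 \<inter> A1)" using fg by (simp add: Int_commute)
  obtain P where P: "P \<in> conjugate_meets G A1" "P \<subseteq> A1" and
    least: "\<And>B. subgroup B G \<Longrightarrow> coset_finite G A2 B \<Longrightarrow> coset_finite G A1 B \<Longrightarrow>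
       coset_finite G (generate G (A2 \<union> P)) B"
    using commensurated_join_virtually_least[OF A2 comm1 fg'] by blast
  interpret P: subgroup P G using conjugate_meets_subgroup[OF A1 P(1)] .
  define E where "E = generate G (A2 \<union> P)"
  have EG: "subgroup E G" unfolding E_def by (rule generate_is_subgroup) auto
  have PE: "P \<subseteq> E" "A2 \<subseteq> E" unfolding E_def by (auto intro: generate.incl)
  have "coset_finite G A1 E"
    by (rule coset_finite_mono[OF commensurated_coset_finite_meet[OF comm1 P(1)]
          subset_refl PE(1) P.subgroup_axioms EG A1.subset])
  then obtain T where T: "finite T" "T \<subseteq> A1" "\<one> \<in> T" and
    fin: "coset_finite G (generate G (A1 \<union> (\<Inter>t\<in>T. conjugate_subgroup G t E))) E"
    using core_virtually_contained[OF A1 EG] by blast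
  have TG: "T \<subseteq> carrier G" "T \<noteq> {}" using T by auto
  define M where "M = (\<Inter>t\<in>T. conjugate_subgroup G t A2)"
  define D where "D = (\<Inter>t\<in>T. conjugate_subgroup G t E)"
  have "conjugate_subgroup G t A2 \<subseteq> conjugate_subgroup G t E" for t
    using PE unfolding conjugate_subgroup_def l_coset_def r_coset_def by blast
  then have MD: "M \<subseteq> D" unfolding M_def D_def by blast
  have DG: "subgroup D G" unfolding D_def
    by (rule subgroup_Inter_conjugates[OF EG TG(2,1)])
  have M: "M \<in> conjugate_meets G A2" unfolding M_def using T(1) TG(2,1) by (rule conjugate_meetsI)
  have MA: "M \<subseteq> A2" unfolding M_def using T(3) conjugate_one[OF A2.subset] by blast
  have GD: "generate G (A1 \<union> D) \<subseteq> carrier G"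
    by (rule generate_incl) (use subgroup.subset[OF DG] in auto)
  have "generate G (A1 \<union> M) \<subseteq> generate G (A1 \<union> D)" by (rule mono_generate) (use MD in auto)
  then have finM: "coset_finite G (generate G (A1 \<union> M)) E"
    by (rule coset_finite_mono[OF fin[folded D_def] _ subset_refl EG EG GD])
  have GM: "generate G (A1 \<union> M) \<subseteq> carrier G"
    by (rule generate_incl) (use MA in auto)
  show thesis
  proof (rule that[OF M MA])
    fix B assume "subgroup B G" "coset_finite G A1 B" "coset_finite G A2 B"
    then show "coset_finite G (generate G (A1 \<union> M)) B"
      using coset_finite_trans[OF finM least[folded E_def] EG _ GM] by blast
  qed
qed

lemma smallest_virtual_containers_commensurable:
  assumes "smallest_virtual_container G A1 A2 A" "smallest_virtual_container G A1 A2 A'"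
  shows "commensurable G A A'"
proof -
  have A: "subgroup A G" "subgroup A' G"
    using assms unfolding smallest_virtual_container_def by simp_all
  moreover have "virtually_contained G A A'" "virtually_contained G A' A"
    using assms unfolding smallest_virtual_container_def by simp_all
  ultimately have fin: "coset_finite G A A'" "coset_finite G A' A"
    by (simp_all add: virtually_contained_iff)
  have "finite_index_subgroup G (A \<inter> A') A" "finite_index_subgroup G (A' \<inter> A) A'"
    by (simp_all add: finite_index_Int_iff A fin)
  then show ?thesis unfolding commensurable_def by (simp add: Int_commute)
qed

lemma smallest_virtual_container_joinI:
  assumes A1: "subgroup A1 G" and A2: "subgroup A2 G" and M: "finite_index_subgroup G M A2"
    and least: "\<And>B. subgroup B G \<Longrightarrow> coset_finite G A1 B \<Longrightarrow> coset_finite G A2 B \<Longrightarrow>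
       coset_finite G (generate G (A1 \<union> M)) B"
  shows "smallest_virtual_container G A1 A2 (generate G (A1 \<union> M))"
proof -
  have "A1 \<union> M \<subseteq> carrier G"
    using A1 M unfolding finite_index_subgroup_def by (auto dest: subgroup.subset)
  then have AG: "subgroup (generate G (A1 \<union> M)) G" by (rule generate_is_subgroup)
  have "finite_index_subgroup G (A1 \<inter> A1) A1"
    unfolding finite_index_Int_iff[OF A1 A1]
    by (rule coset_finite_criterion[where f = "\<lambda>_. ()"])
      (use A1 subgroup.subset[OF A1] in \<open>auto simp: subgroup.m_closed subgroup.m_inv_closed\<close>)
  then have "virtually_contained G A1 (generate G (A1 \<union> M))"
    unfolding virtually_contained_def by (auto intro: generate.incl)
  moreover have "virtually_contained G A2 (generate G (A1 \<union> M))"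
    unfolding virtually_contained_def using M by (auto intro: generate.incl)
  moreover have "virtually_contained G (generate G (A1 \<union> M)) B"
    if B: "subgroup B G" "virtually_contained G A1 B" "virtually_contained G A2 B" for B
    using least[OF B(1)] B(2,3)
    by (simp add: virtually_contained_iff[OF _ B(1)] A1 A2 AG)
  ultimately show ?thesis unfolding smallest_virtual_container_def using AG by blast
qed

end

theorem theorem3p5:
  fixes C :: "('a, 'b) monoid_scheme" and A1 A2 :: "'a set"
  assumes "group C" and "subgroup A1 C" and "subgroup A2 C"
    and "(commensurated C A2 \<and> finitely_generated_over C A1 (A1 \<inter> A2)) \<or>
         (commensurated C A1 \<and> commensurated C A2 \<and> finitely_generated_over C A2 (A1 \<inter> A2))"
  shows "(\<exists>A. smallest_virtual_container C A1 A2 A) \<and>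
    (\<forall>A A'. smallest_virtual_container C A1 A2 A \<and> smallest_virtual_container C A1 A2 A' \<longrightarrow>
       commensurable C A A') \<and>
    (\<exists>A2' S. finite_index_subgroup C A2' A2 \<and>
       finite S \<and> S \<noteq> {} \<and> S \<subseteq> carrier C \<and> A2' = (\<Inter>c\<in>S. conjugate_subgroup C c A2) \<and>
       smallest_virtual_container C A1 A2 (generate C (A1 \<union> A2')))"
proof -
  interpret group C by fact
  have comm: "commensurated C A2" using assms(4) by blast
  obtain M where M: "M \<in> conjugate_meets C A2" "M \<subseteq> A2" and
    least: "\<And>B. subgroup B C \<Longrightarrow> coset_finite C A1 B \<Longrightarrow> coset_finite C A2 B \<Longrightarrow>
       coset_finite C (generate C (A1 \<union> M)) B"
    using assms(4) commensurated_join_virtually_least[OF assms(2)]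
      commensurated_join_virtually_least_symmetric by blast
  have fi: "finite_index_subgroup C M A2" unfolding finite_index_subgroup_iff
    using conjugate_meets_subgroup[OF assms(3) M(1)] assms(3) M(2)
      commensurated_coset_finite_meet[OF comm M(1)] by blast
  have small: "smallest_virtual_container C A1 A2 (generate C (A1 \<union> M))"
    by (rule smallest_virtual_container_joinI[OF assms(2,3) fi least])
  obtain S where "finite S" "S \<noteq> {}" "S \<subseteq> carrier C" "M = (\<Inter>c\<in>S. conjugate_subgroup C c A2)"
    using M(1) by (rule conjugate_meetsE)
  then show ?thesis using small fi smallest_virtual_containers_commensurable by blast
qed

end
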